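(* Let $\alpha\in\mathbb{C}\setminus\{1\}$, let $a_{12},a_{23}\in\mathbb{C}$, and put $$r_1=a_{12}(e_1\otimes e_2-e_2\otimes e_1),\qquad r_2=a_{23}(e_2\otimes e_3-e_3\otimes e_2)\in\mathcal{H}_\alpha\otimes\mathcal{H}_\alpha .$$ For $t\in\{1,2\}$ let $\Delta_t:\mathcal{H}_\alpha\to\mathcal{H}_\alpha\otimes\mathcal{H}_\alpha$ be the linear map $$\Delta_t(x)=(\mathrm{id}\otimes L(x)-R(x)\otimes \mathrm{id})\,r_t,\qquad x\in\mathcal{H}_\alpha .$$ Then $(\mathcal{H}_\alpha,\Delta_t)$ is an antisymmetric infinitesimal bialgebra for $t=1,2$.
   Context: $\mathcal{H}_\alpha$ is the complex associative algebra with basis $e_1,e_2,e_3$ and product $e_1\cdot e_3=e_2$, $e_3\cdot e_1=\alpha e_2$, all other products of basis vectors zero. For an associative algebra $\mathcal{A}$, $L(x)y=x\cdot y$ and $R(x)y=y\cdot x$. Let $\sigma(x\otimes y)=y\otimes x$. An antisymmetric infinitesimal bialgebra structure on a finite-dimensional associative algebra $\mathcal{A}$ is a linear map $\Delta:\mathcal{A}\to\mathcal{A}\otimes\mathcal{A}$ such that: (1) the dual map $\Delta^*:\mathcal{A}^*\otimes\mathcal{A}^*\to\mathcal{A}^*$, $\langle \Delta^*(a^*\otimes b^* ),x\rangle=\langle a^*\otimes b^*,\Delta(x)\rangle$, is an associative product on $\mathcal{A}^*$; (2) for all $x,y\in\mathcal{A}$, $$\Delta(x\cdot y)=(\mathrm{id}\otimes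 L(x))\Delta(y)+(R(y)\otimes \mathrm{id})\Delta(x),$$ $$(L(y)\otimes \mathrm{id}-\mathrm{id}\otimes R(y))\Delta(x)+\sigma\big[(L(x)\otimes \mathrm{id}-\mathrm{id}\otimes R(x))\Delta(y)\big]=0 .$$ *)

theory Defs
  imports "HOL-Analysis.Analysis"
begin

text \<open>
  A finite-dimensional complex vector space is taken as \<open>complex ^ 'n\<close>, with standard basis
  \<open>bas i\<close>. Its tensor square is \<open>complex ^ ('n \<times> 'n)\<close>, the coordinates being those with respect
  to the basis \<open>bas i \<otimes> bas j = bas (i, j)\<close>. Linearity is over the complex numbers, hence
  \<open>Vector_Spaces.linear\<close> with the scaling \<open>*s\<close> (the constant \<open>linear\<close> is only real-linear).
\<close>

abbreviation bas :: "'n::finite \<Rightarrow> complex ^ 'n"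
  where "bas i \<equiv> axis i 1"

abbreviation clinear :: "(complex ^ 'n \<Rightarrow> complex ^ 'm) \<Rightarrow> bool"
  where "clinear \<equiv> Vector_Spaces.linear (*s) (*s)"

definition dual_space :: "(complex ^ 'n \<Rightarrow> complex) set"
  where "dual_space = {f. Vector_Spaces.linear (*s) (*) f}"

definition tensor :: "complex ^ 'n::finite \<Rightarrow> complex ^ 'm::finite \<Rightarrow> complex ^ ('n \<times> 'm)"  (infixr "\<otimes>" 75)
  where "x \<otimes> y = (\<chi> p. x $ fst p * y $ snd p)"

definition tensor_map ::
    "(complex ^ 'n::finite \<Rightarrow> complex ^ 'k) \<Rightarrow> (complex ^ 'm::finite \<Rightarrow> complex ^ 'l) \<Rightarrow>
     complex ^ ('n \<times> 'm) \<Rightarrow> complex ^ ('k \<times> 'l)"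
  where "tensor_map f g t = (\<Sum>i\<in>UNIV. \<Sum>j\<in>UNIV. t $ (i, j) *s (f (bas i) \<otimes> g (bas j)))"

definition tensor_flip :: "complex ^ ('n::finite \<times> 'm::finite) \<Rightarrow> complex ^ ('m \<times> 'n)"
  where "tensor_flip t = (\<chi> p. t $ (snd p, fst p))"

text \<open>The value \<open>\<langle>f \<otimes> g, t\<rangle>\<close>, for functionals \<open>f\<close> and \<open>g\<close>.\<close>

definition tensor_pair ::
    "(complex ^ 'n::finite \<Rightarrow> complex) \<Rightarrow> (complex ^ 'm::finite \<Rightarrow> complex) \<Rightarrow>
     complex ^ ('n \<times> 'm) \<Rightarrow> complex"
  where "tensor_pair f g t = (\<Sum>i\<in>UNIV. \<Sum>j\<in>UNIV. t $ (i, j) * (f (bas i) * g (bas j)))"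

lemma bas_tensor_bas: "bas i \<otimes> bas j = bas (i, j)"
  by (auto simp: tensor_def axis_def vec_eq_iff)

lemma clinear_tensor_left: "clinear (\<lambda>x. x \<otimes> y)"
  by unfold_locales (auto simp: tensor_def vec_eq_iff algebra_simps)

lemma clinear_tensor_right: "clinear (\<lambda>y. x \<otimes> y)"
  by unfold_locales (auto simp: tensor_def vec_eq_iff algebra_simps)

lemma clinear_tensor_map: "clinear (tensor_map f g)"
  by unfold_locales
    (auto simp: tensor_map_def vec_eq_iff algebra_simps sum.distrib sum_distrib_left)

lemma linear_bas_expand:
  assumes "Vector_Spaces.linear (*s) s f"
  shows "f (x :: complex ^ 'n::finite) = (\<Sum>i\<in>UNIV. s (x $ i) (f (bas i)))"
proof -
  interpret l: Vector_Spaces.linear "(*s)" s f by fact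
  have "f x = f (\<Sum>i\<in>UNIV. x $ i *s bas i)"
    by (simp add: basis_expansion)
  then show ?thesis
    by (simp add: l.sum l.scale)
qed

lemma tensor_map_tensor:
  assumes "clinear f" "clinear g"
  shows "tensor_map f g (x \<otimes> y) = f x \<otimes> g y"
  unfolding linear_bas_expand[OF assms(1), of x] linear_bas_expand[OF assms(2), of y]
  by (simp add: tensor_map_def tensor_def vec_eq_iff sum_product mult_ac)

lemma tensor_flip_tensor: "tensor_flip (x \<otimes> y) = y \<otimes> x"
  by (simp add: tensor_flip_def tensor_def vec_eq_iff mult.commute)

lemma clinear_tensor_flip: "clinear tensor_flip"
  by unfold_locales (auto simp: tensor_flip_def vec_eq_iff)

lemma tensor_pair_tensor:
  assumes "f \<in> dual_space" "g \<in> dual_space"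
  shows "tensor_pair f g (x \<otimes> y) = f x * g y"
proof -
  have "f x = (\<Sum>i\<in>UNIV. x $ i * f (bas i))" "g y = (\<Sum>i\<in>UNIV. y $ i * g (bas i))"
    using assms by (auto simp: dual_space_def intro: linear_bas_expand)
  then show ?thesis
    by (simp add: tensor_pair_def tensor_def sum_product mult_ac)
qed

definition assoc_algebra ::
    "(complex ^ 'n::finite \<Rightarrow> complex ^ 'n \<Rightarrow> complex ^ 'n) \<Rightarrow> bool"
  where "assoc_algebra m \<longleftrightarrow>
    (\<forall>x. clinear (m x)) \<and> (\<forall>y. clinear (\<lambda>x. m x y)) \<and>
    (\<forall>x y z. m (m x y) z = m x (m y z))"

definition Lmult :: "('a \<Rightarrow> 'a \<Rightarrow> 'a) \<Rightarrow> 'a \<Rightarrow> 'a \<Rightarrow> 'a"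
  where "Lmult m x y = m x y"

definition Rmult :: "('a \<Rightarrow> 'a \<Rightarrow> 'a) \<Rightarrow> 'a \<Rightarrow> 'a \<Rightarrow> 'a"
  where "Rmult m x y = m y x"

text \<open>The functional \<open>\<Delta>\<^sup>*(f \<otimes> g)\<close>.\<close>

definition dual_prod ::
    "(complex ^ 'n::finite \<Rightarrow> complex ^ ('n \<times> 'n)) \<Rightarrow>
     (complex ^ 'n \<Rightarrow> complex) \<Rightarrow> (complex ^ 'n \<Rightarrow> complex) \<Rightarrow> complex ^ 'n \<Rightarrow> complex"
  where "dual_prod \<Delta> f g = (\<lambda>x. tensor_pair f g (\<Delta> x))"

text \<open>
  Bilinearity of \<open>dual_prod \<Delta>\<close> and closure of the dual space under it hold for every linear
  \<open>\<Delta>\<close>, so that being an associative product on the dual space amounts to associativity.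
\<close>

lemma dual_prod_in_dual_space: "clinear \<Delta> \<Longrightarrow> dual_prod \<Delta> f g \<in> dual_space"
proof -
  assume "clinear \<Delta>"
  then interpret l: Vector_Spaces.linear "(*s)" "(*s)" \<Delta> .
  show ?thesis
    unfolding dual_space_def mem_Collect_eq
    by unfold_locales
      (auto simp: dual_prod_def tensor_pair_def l.add l.scale algebra_simps
        sum.distrib sum_distrib_left)
qed

lemma dual_prod_bilinear:
  "dual_prod \<Delta> (\<lambda>x. f x + f' x) g = (\<lambda>x. dual_prod \<Delta> f g x + dual_prod \<Delta> f' g x)"
  "dual_prod \<Delta> f (\<lambda>x. g x + g' x) = (\<lambda>x. dual_prod \<Delta> f g x + dual_prod \<Delta> f g' x)"
  "dual_prod \<Delta> (\<lambda>x. c * f x) g = (\<lambda>x. c * dual_prod \<Delta> f g x)"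
  "dual_prod \<Delta> f (\<lambda>x. c * g x) = (\<lambda>x. c * dual_prod \<Delta> f g x)"
  by (auto simp: dual_prod_def tensor_pair_def algebra_simps sum.distrib sum_distrib_left)

definition antisym_inf_bialgebra ::
    "(complex ^ 'n::finite \<Rightarrow> complex ^ 'n \<Rightarrow> complex ^ 'n) \<Rightarrow>
     (complex ^ 'n \<Rightarrow> complex ^ ('n \<times> 'n)) \<Rightarrow> bool"
  where "antisym_inf_bialgebra m \<Delta> \<longleftrightarrow>
    assoc_algebra m \<and> clinear \<Delta> \<and>
    (\<forall>f\<in>dual_space. \<forall>g\<in>dual_space. \<forall>h\<in>dual_space.
       dual_prod \<Delta> (dual_prod \<Delta> f g) h = dual_prod \<Delta> f (dual_prod \<Delta> g h)) \<and>
    (\<forall>x y. \<Delta> (m x y) =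
       tensor_map id (Lmult m x) (\<Delta> y) + tensor_map (Rmult m y) id (\<Delta> x)) \<and>
    (\<forall>x y.
       (tensor_map (Lmult m y) id (\<Delta> x) - tensor_map id (Rmult m y) (\<Delta> x)) +
       tensor_flip (tensor_map (Lmult m x) id (\<Delta> y) - tensor_map id (Rmult m x) (\<Delta> y)) = 0)"

definition coboundary ::
    "(complex ^ 'n::finite \<Rightarrow> complex ^ 'n \<Rightarrow> complex ^ 'n) \<Rightarrow> complex ^ ('n \<times> 'n) \<Rightarrow>
     complex ^ 'n \<Rightarrow> complex ^ ('n \<times> 'n)"
  where "coboundary m r x = tensor_map id (Lmult m x) r - tensor_map (Rmult m x) id r"

text \<open>In the index type \<open>3\<close> the numeral \<open>3\<close> equals \<open>0\<close>; \<open>1\<close>, \<open>2\<close>, \<open>3\<close> are its three distinct elements.\<close>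

definition H_basis_prod :: "complex \<Rightarrow> 3 \<Rightarrow> 3 \<Rightarrow> complex ^ 3"
  where "H_basis_prod \<alpha> i j =
    (if i = 1 \<and> j = 3 then bas 2
     else if i = 3 \<and> j = 1 then \<alpha> *s bas 2
     else 0)"

definition H_prod :: "complex \<Rightarrow> complex ^ 3 \<Rightarrow> complex ^ 3 \<Rightarrow> complex ^ 3"
  where "H_prod \<alpha> x y = (\<Sum>i\<in>UNIV. \<Sum>j\<in>UNIV. (x $ i * y $ j) *s H_basis_prod \<alpha> i j)"

lemma H_prod_bas: "H_prod \<alpha> (bas i) (bas j) = H_basis_prod \<alpha> i j"
proof -
  have "H_prod \<alpha> (bas i) (bas j) =
      (\<Sum>k\<in>UNIV. \<Sum>l\<in>UNIV. if k = i then if l = j then H_basis_prod \<alpha> k l else 0 else 0)"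
    unfolding H_prod_def by (intro sum.cong refl) (auto simp: axis_def)
  also have "\<dots> = (\<Sum>k\<in>UNIV. if k = i then H_basis_prod \<alpha> k j else 0)"
    by (intro sum.cong refl) auto
  finally show ?thesis by simp
qed

end

theory Submission
  imports Defs
begin

text \<open>
  The element \<open>e\<^sub>2\<close> spans the square of the algebra and annihilates it on both sides. Evaluating
  the coboundaries gives \<open>\<Delta>\<^sub>1 x = - a\<^sub>1\<^sub>2 (1 + \<alpha>) x\<^sub>3 e\<^sub>2 \<otimes> e\<^sub>2\<close> and
  \<open>\<Delta>\<^sub>2 x = a\<^sub>2\<^sub>3 (1 + \<alpha>) x\<^sub>1 e\<^sub>2 \<otimes> e\<^sub>2\<close>. Each is of the form \<open>x \<mapsto> \<phi> x (u \<otimes> u)\<close> with \<open>u\<close> in the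
  annihilator and \<open>\<phi>\<close> vanishing on products and on \<open>u\<close>; for such a map both sides of every
  axiom are zero.
\<close>

lemma tensor_zero [simp]: "0 \<otimes> y = 0" "x \<otimes> 0 = 0"
  by (simp_all add: tensor_def vec_eq_iff)

lemma tensor_map_scale: "tensor_map f g (c *s t) = c *s tensor_map f g t"
proof -
  interpret Vector_Spaces.linear "(*s)" "(*s)" "tensor_map f g"
    by (rule clinear_tensor_map)
  show ?thesis by (rule scale)
qed

lemma tensor_map_diff: "tensor_map f g (s - t) = tensor_map f g s - tensor_map f g t"
proof -
  interpret Vector_Spaces.linear "(*s)" "(*s)" "tensor_map f g"
    by (rule clinear_tensor_map)
  show ?thesis by (rule diff)
qed

lemma clinear_id: "clinear id"
  by unfold_locales auto

lemma assoc_algebra_clinear_mult: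
  assumes "assoc_algebra m"
  shows "clinear (Lmult m x)" "clinear (Rmult m x)"
  using assms by (simp_all add: assoc_algebra_def Lmult_def [abs_def] Rmult_def [abs_def])

text \<open>\<open>tensor_map\<close> is defined by basis expansion; bilinearity of \<open>m\<close>
  is what lets it be evaluated factorwise on pure tensors.\<close>

lemma tensor_map_mult_tensor:
  assumes "assoc_algebra m"
  shows "tensor_map id (Lmult m x) (u \<otimes> v) = u \<otimes> m x v"
    and "tensor_map (Lmult m x) id (u \<otimes> v) = m x u \<otimes> v"
    and "tensor_map id (Rmult m x) (u \<otimes> v) = u \<otimes> m v x"
    and "tensor_map (Rmult m x) id (u \<otimes> v) = m u x \<otimes> v"
  using assoc_algebra_clinear_mult [OF assms]
  by (simp_all add: tensor_map_tensor clinear_id Lmult_def Rmult_def)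

lemma antisym_inf_bialgebra_annihilator:
  assumes m: "assoc_algebra m"
    and \<phi>: "\<phi> \<in> dual_space"
    and u: "\<And>x. m x u = 0" "\<And>x. m u x = 0"
    and \<phi>_0: "\<And>x y. \<phi> (m x y) = 0" "\<phi> u = 0"
  shows "antisym_inf_bialgebra m (\<lambda>x. \<phi> x *s (u \<otimes> u))"
proof -
  let ?\<Delta> = "\<lambda>x. \<phi> x *s (u \<otimes> u)"
  interpret \<phi>: Vector_Spaces.linear "(*s)" "(*)" \<phi>
    using \<phi> by (simp add: dual_space_def)
  have \<Delta>: "clinear ?\<Delta>"
    by unfold_locales (simp_all add: vec_eq_iff \<phi>.add \<phi>.scale algebra_simps)
  have dual_prod: "dual_prod ?\<Delta> f g = (\<lambda>x. \<phi> x * (f u * g u))"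
    if "f \<in> dual_space" "g \<in> dual_space" for f g
  proof
    fix x
    have "tensor_pair f g (\<phi> x *s (u \<otimes> u)) = \<phi> x * tensor_pair f g (u \<otimes> u)"
      by (simp add: tensor_pair_def sum_distrib_left mult.assoc)
    then show "dual_prod ?\<Delta> f g x = \<phi> x * (f u * g u)"
      by (simp add: dual_prod_def tensor_pair_tensor that)
  qed
  have "dual_prod ?\<Delta> (dual_prod ?\<Delta> f g) h = dual_prod ?\<Delta> f (dual_prod ?\<Delta> g h)"
    if "f \<in> dual_space" "g \<in> dual_space" "h \<in> dual_space" for f g h
  proof -
    \<comment> \<open>A dual product is a multiple of \<phi>, so it vanishes at \<open>u\<close>;
      each bracketing of a triple product contains such a value as a factor.\<close>
    have "dual_prod ?\<Delta> f g u = 0" "dual_prod ?\<Delta> g h u = 0"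
      using that by (simp_all add: dual_prod \<phi>_0)
    then show ?thesis
      by (simp add: dual_prod [OF dual_prod_in_dual_space [OF \<Delta>] that(3)]
          dual_prod [OF that(1) dual_prod_in_dual_space [OF \<Delta>]])
  qed
  moreover have "tensor_flip 0 = (0 :: complex ^ ('a \<times> 'a))"
    by (simp add: tensor_flip_def vec_eq_iff)
  ultimately show ?thesis
    \<comment> \<open>In both compatibility conditions every multiplication operator meets a factor
      \<open>u\<close> and gives zero; the remaining term \<open>\<Delta> (m x y)\<close> dies
      because \<phi> kills products.\<close>
    unfolding antisym_inf_bialgebra_def
    by (simp add: m \<Delta> tensor_map_scale tensor_map_mult_tensor u \<phi>_0)
qed

lemma H_prod_eq: "H_prod \<alpha> x y = (x $ 1 * y $ 3 + \<alpha> * (x $ 3 * y $ 1)) *s bas 2"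
  by (simp add: H_prod_def H_basis_prod_def sum_3 vec_eq_iff algebra_simps)

text \<open>Products are multiples of \<open>bas 2\<close>, while the product reads only coordinates
  1 and 3, so both triple products are zero.\<close>

lemma assoc_algebra_H_prod: "assoc_algebra (H_prod \<alpha>)"
proof -
  have "clinear (H_prod \<alpha> x)" "clinear (\<lambda>x. H_prod \<alpha> x y)" for x y
    by (unfold_locales; simp add: H_prod_eq vec_eq_iff algebra_simps)+
  then show ?thesis
    by (simp add: assoc_algebra_def H_prod_eq) (simp add: axis_def)
qed

text \<open>Only the factor other than \<open>bas 2\<close> survives multiplication. Left and right
  multiplication contribute 1 and \<alpha> in some order, and antisymmetry of the tensor makes them
  add up to \<open>1 + \<alpha>\<close>.\<close>

lemma coboundary_H_prod:
  "coboundary (H_prod \<alpha>) (a *s (bas 1 \<otimes> bas 2 - bas 2 \<otimes> bas 1)) =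
    (\<lambda>x. (- a * (1 + \<alpha>) * x $ 3) *s (bas 2 \<otimes> bas 2))"
  "coboundary (H_prod \<alpha>) (a *s (bas 2 \<otimes> bas 3 - bas 3 \<otimes> bas 2)) =
    (\<lambda>x. (a * (1 + \<alpha>) * x $ 1) *s (bas 2 \<otimes> bas 2))"
  by (rule ext; simp add: coboundary_def tensor_map_scale tensor_map_diff
      tensor_map_mult_tensor [OF assoc_algebra_H_prod];
      simp add: H_prod_eq tensor_def vec_eq_iff axis_def algebra_simps)+

text \<open>For \<open>i \<noteq> 2\<close> the coordinate functional vanishes on
  \<open>bas 2\<close>, hence on all products.\<close>

lemma antisym_inf_bialgebra_H_prod:
  assumes "i \<noteq> 2"
  shows "antisym_inf_bialgebra (H_prod \<alpha>) (\<lambda>x. (c * x $ i) *s (bas 2 \<otimes> bas 2))"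
proof (rule antisym_inf_bialgebra_annihilator [OF assoc_algebra_H_prod])
  show "(\<lambda>x. c * x $ i) \<in> dual_space"
    unfolding dual_space_def mem_Collect_eq
    by unfold_locales (simp_all add: algebra_simps)
qed (use assms in \<open>simp_all add: H_prod_eq axis_def\<close>)

theorem proposition3p7:
  fixes \<alpha> a12 a23 :: complex
  fixes r1 r2 :: "complex ^ (3 \<times> 3)"
  assumes "\<alpha> \<noteq> 1"
  assumes "r1 = a12 *s (bas 1 \<otimes> bas 2 - bas 2 \<otimes> bas 1)"
  assumes "r2 = a23 *s (bas 2 \<otimes> bas 3 - bas 3 \<otimes> bas 2)"
  shows "antisym_inf_bialgebra (H_prod \<alpha>) (coboundary (H_prod \<alpha>) r1) \<and>
         antisym_inf_bialgebra (H_prod \<alpha>) (coboundary (H_prod \<alpha>) r2)"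
  unfolding assms(2,3) coboundary_H_prod
  by (intro conjI antisym_inf_bialgebra_H_prod) simp_all

end
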